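(* Let $a<0$, $b>0$, and let $\alpha=\frac{a\sqrt2}{\sqrt b}$, $\beta=\sqrt{2b}$. Let $0\le\eta<\theta$. For $x\in(\eta,\theta)$ let $X$ be the solution of $dX(t)=(a+bX(t))\,dt+dB(t)$, $X(0)=x$, where $B$ is a standard Wiener process. Let $T$ be the first time $X$ hits $\{\eta,\theta\}$, let $\rho(x)$ be the probability that $X$ reaches $\eta$ before $\theta$, and let $\psi(x)=E[T]$. Let the harvest function be $Q(y)=y-x$, and let $Q$ also denote the random harvest, equal to $Q(\eta)$ if $\eta$ is reached before $\theta$ and to $Q(\theta)$ otherwise, so that $$\frac{E[Q]}{E[T]}=\frac{Q(\theta)+(Q(\eta)-Q(\theta))\rho(x)}{\psi(x)}=\frac{(\theta-x)+(\eta-\theta)\rho(x)}{\psi(x)}.$$ Let $\phi$ and $\Phi$ be the standard Gaussian density and distribution function. Then: A) If $\gamma(\theta)=\lim_{x\to\eta}\frac{E[Q]}{E[T]}$ (limit over $x\in(\eta,\theta)$), then $\gamma(\theta)$ has the same sign (positive, zero or negative) as $$\Phi(\alpha+\beta\eta)+\beta\,\phi(\alpha+\beta\eta)(\theta-\eta)-\Phi(\alpha+\beta\theta).$$ In particular, $\gamma(\theta)>0$ whenever $-\frac{\alpha}{\beta}\le\eta<\theta$. B) If $\gamma(\theta)=\lim_{x\to\theta}\frac{E[Q]}{E[T]}$ (limit over $x\in(\eta,\theta)$), then $\gamma(\theta)$ has the same sign (positive, zero or negative) as $$\Phi(\alpha+\beta\theta)+\beta\,\phi(\alpha+\beta\t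heta)(\eta-\theta)-\Phi(\alpha+\beta\eta).$$
   Context: Here $\phi(v)=\frac1{\sqrt{2\pi}}e^{-v^2/2}$ and $\Phi(u)=\int_{-\infty}^u\phi(v)\,dv$. The level $\eta$ is held fixed. By well-known results on diffusion processes, for $x\in(\eta,\theta)$ the functionals $\rho$ and $\psi$ are given by $$\rho(x)=\frac{\Phi(\alpha+\beta\theta)-\Phi(\alpha+\beta x)}{\Phi(\alpha+\beta\theta)-\Phi(\alpha+\beta\eta)},$$ $$\psi(x)=\frac2\beta\left(\rho(x)\int_\eta^x\frac{\Phi(\alpha+\beta u)-\Phi(\alpha+\beta\eta)}{\phi(\alpha+\beta u)}\,du+(1-\rho(x))\int_x^\theta\frac{\Phi(\alpha+\beta\theta)-\Phi(\alpha+\beta u)}{\phi(\alpha+\beta u)}\,du\right),$$ and these formulas may be taken as the definitions of $\rho(x)$ and $\psi(x)=E[T]$. *)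

theory Defs
  imports "HOL-Probability.Probability"
begin

abbreviation Phi_normal :: "real \<Rightarrow> real" where
  "Phi_normal u \<equiv> (LBINT v:{..u}. std_normal_density v)"

text \<open>
  For the diffusion \<open>dX = (a + b X) dt + dB\<close>, \<open>X 0 = x\<close>, with \<open>\<alpha> = a \<surd>2 / \<surd>b\<close> and
  \<open>\<beta> = \<surd>(2 b)\<close>, \<open>hit_prob\<close> is the probability of reaching \<open>\<eta>\<close> before \<open>\<theta>\<close> and
  \<open>exit_mean\<close> is the expected first hitting time of \<open>{\<eta>, \<theta>}\<close>.  The closed formulas,
  well known for scalar diffusions, are taken as the definitions; they are meant for
  \<open>\<eta> < x < \<theta>\<close>.
\<close>

definition hit_prob :: "real \<Rightarrow> real \<Rightarrow> real \<Rightarrow> real \<Rightarrow> real \<Rightarrow> real" where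
  "hit_prob \<alpha> \<beta> \<eta> \<theta> x =
     (Phi_normal (\<alpha> + \<beta> * \<theta>) - Phi_normal (\<alpha> + \<beta> * x)) /
     (Phi_normal (\<alpha> + \<beta> * \<theta>) - Phi_normal (\<alpha> + \<beta> * \<eta>))"

definition exit_mean :: "real \<Rightarrow> real \<Rightarrow> real \<Rightarrow> real \<Rightarrow> real \<Rightarrow> real" where
  "exit_mean \<alpha> \<beta> \<eta> \<theta> x =
     2 / \<beta> *
     (hit_prob \<alpha> \<beta> \<eta> \<theta> x *
        (LBINT u:{\<eta>..x}. (Phi_normal (\<alpha> + \<beta> * u) - Phi_normal (\<alpha> + \<beta> * \<eta>)) /
                          std_normal_density (\<alpha> + \<beta> * u)) +
      (1 - hit_prob \<alpha> \<beta> \<eta> \<theta> x) *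
        (LBINT u:{x..\<theta>}. (Phi_normal (\<alpha> + \<beta> * \<theta>) - Phi_normal (\<alpha> + \<beta> * u)) /
                          std_normal_density (\<alpha> + \<beta> * u)))"

definition harvest :: "real \<Rightarrow> real \<Rightarrow> real" where
  "harvest x y = y - x"

text \<open>
  The random harvest equals \<open>harvest x \<eta>\<close> with probability \<open>hit_prob \<alpha> \<beta> \<eta> \<theta> x\<close> and
  \<open>harvest x \<theta>\<close> otherwise.
\<close>

definition harvest_mean :: "real \<Rightarrow> real \<Rightarrow> real \<Rightarrow> real \<Rightarrow> real \<Rightarrow> real" where
  "harvest_mean \<alpha> \<beta> \<eta> \<theta> x =
     harvest x \<theta> + (harvest x \<eta> - harvest x \<theta>) * hit_prob \<alpha> \<beta> \<eta> \<theta> x"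

definition harvest_rate :: "real \<Rightarrow> real \<Rightarrow> real \<Rightarrow> real \<Rightarrow> real \<Rightarrow> real" where
  "harvest_rate \<alpha> \<beta> \<eta> \<theta> x = harvest_mean \<alpha> \<beta> \<eta> \<theta> x / exit_mean \<alpha> \<beta> \<eta> \<theta> x"

end

theory Submission
  imports Defs
begin

text \<open>
  The expected harvest and the expected exit time both vanish at the two endpoints, so the limit
  of their quotient is the quotient of their derivatives there.  The derivative of the expected
  exit time reduces to a positive integral times the derivative of the hitting probability, up to
  a constant factor; it is positive at \<open>\<eta>\<close> and negative at \<open>\<theta>\<close>, so the sign is that of the
  derivative of the expected harvest at \<open>\<eta>\<close> and the opposite one at \<open>\<theta>\<close>.  To the right of
  \<open>-\<alpha>/\<beta>\<close> the Gaussian density decreases, and the mean value theorem makes the first sign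
  positive.
\<close>

text \<open>Dividing both functions by \<open>x - c\<close> turns the quotient into a quotient of
  difference quotients. In contrast to l'Hopital's rule, this asks for derivatives only at
  \<open>c\<close>, and relative to \<open>S\<close>, which suits an endpoint of an
  interval.\<close>

lemma DERIV_quotient_tendsto:
  fixes f g :: "real \<Rightarrow> real"
  assumes "(f has_real_derivative f') (at c within S)" "(g has_real_derivative g') (at c within S)"
    and "f c = 0" "g c = 0" "g' \<noteq> 0"
  shows "((\<lambda>x. f x / g x) \<longlongrightarrow> f' / g') (at c within S)"
proof -
  have "((\<lambda>x. (f x / (x - c)) / (g x / (x - c))) \<longlongrightarrow> f' / g') (at c within S)"
    using assms by (intro tendsto_divide) (simp_all add: has_field_derivative_iff)
  moreover have "\<forall>\<^sub>F x in at c within S. (f x / (x - c)) / (g x / (x - c)) = f x / g x"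
    by (auto simp: eventually_at_filter)
  ultimately show ?thesis
    by (rule Lim_transform_eventually)
qed

section \<open>Calculus of the Gaussian density and distribution function\<close>

lemma std_normal_density_neq_0 [simp]: "std_normal_density u \<noteq> 0"
  using normal_density_pos[of 1 0 u] by simp

lemma continuous_on_std_normal_density:
  "continuous_on S g \<Longrightarrow> continuous_on S (\<lambda>x. std_normal_density (g x))"
  unfolding std_normal_density_def by (intro continuous_intros) auto

lemma set_integrable_std_normal_density:
  "S \<in> sets lborel \<Longrightarrow> set_integrable lborel S std_normal_density"
  unfolding set_integrable_def by (intro integrable_mult_indicator integrable_normal_density) auto

text \<open>Passes from the Lebesgue integrals of the definitions to gauge integrals, to which the
  fundamental theorem of calculus is applied below.\<close>

lemma LBINT_cbox_eq_integral:
  fixes f :: "real \<Rightarrow> real"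
  assumes "continuous_on {s..t} f"
  shows "(LBINT u:{s..t}. f u) = integral {s..t} f"
  using borel_integrable_atLeastAtMost'[OF assms] by (rule set_borel_integral_eq_integral)

lemma DERIV_Phi_normal: "(Phi_normal has_real_derivative std_normal_density x) (at x)"
proof -
  \<comment> \<open>Cutting at a point left of \<open>x\<close> makes the unbounded tail a constant
    and leaves an integral over a compact interval. Since \<open>x\<close> is interior to
    \<open>{?c..x+1}\<close>, the derivative within that interval is the full derivative.\<close>
  let ?c = "x - 1"
  have split: "Phi_normal u = (LBINT v:{..<?c}. std_normal_density v) + integral {?c..u} std_normal_density"
    if "?c \<le> u" for u
  proof -
    have "{..u} = {..<?c} \<union> {?c..u}"
      using that by auto
    moreover have "{..<?c} \<inter> {?c..u} = {}"
      by auto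
    ultimately have "Phi_normal u = (LBINT v:{..<?c}. std_normal_density v) + (LBINT v:{?c..u}. std_normal_density v)"
      by (simp add: set_integral_Un set_integrable_std_normal_density)
    then show ?thesis
      by (simp add: LBINT_cbox_eq_integral continuous_on_std_normal_density)
  qed
  have "((\<lambda>u. integral {?c..u} std_normal_density) has_real_derivative std_normal_density x) (at x within {?c..x+1})"
    by (intro integral_has_real_derivative) (auto intro: continuous_on_std_normal_density)
  then have "((\<lambda>u. (LBINT v:{..<?c}. std_normal_density v) + integral {?c..u} std_normal_density)
      has_real_derivative std_normal_density x) (at x within {?c..x+1})"
    by (auto intro!: derivative_eq_intros)
  then have "(Phi_normal has_real_derivative std_normal_density x) (at x within {?c..x+1})"
    by (rule has_field_derivative_transform_within[where d=1]) (auto simp: split)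
  moreover have "at x within {?c..x+1} = at x"
    by (rule at_within_Icc_at) simp_all
  ultimately show ?thesis
    by metis
qed

lemma DERIV_Phi_normal_affine:
  "((\<lambda>u. Phi_normal (\<alpha> + \<beta> * u)) has_real_derivative \<beta> * std_normal_density (\<alpha> + \<beta> * u)) (at u within S)"
proof -
  have "((\<lambda>u. \<alpha> + \<beta> * u) has_real_derivative \<beta>) (at u within S)"
    by (auto intro!: derivative_eq_intros)
  from DERIV_chain2[OF DERIV_Phi_normal this] show ?thesis
    by (simp add: mult.commute)
qed

lemma continuous_on_Phi_normal_affine:
  "continuous_on S (\<lambda>u. Phi_normal (\<alpha> + \<beta> * u))"
  by (rule DERIV_continuous_on, rule DERIV_Phi_normal_affine)

lemma Phi_normal_affine_strict_mono:
  assumes "\<beta> > 0" "s < t"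
  shows "Phi_normal (\<alpha> + \<beta> * s) < Phi_normal (\<alpha> + \<beta> * t)"
proof (rule DERIV_pos_imp_increasing[OF assms(2)])
  fix u
  have "0 < \<beta> * std_normal_density (\<alpha> + \<beta> * u)"
    by (intro mult_pos_pos assms(1)) (simp add: normal_density_pos)
  then show "\<exists>y. ((\<lambda>u. Phi_normal (\<alpha> + \<beta> * u)) has_real_derivative y) (at u) \<and> 0 < y"
    using DERIV_Phi_normal_affine by metis
qed

text \<open>Continuity extends nonnegativity to the endpoints, and a vanishing integral would then
  force \<open>f\<close> to be zero at interior points too. Positivity is asked only inside because
  each exit integrand vanishes at one endpoint.\<close>

lemma integral_pos_if_pos_interior:
  fixes f :: "real \<Rightarrow> real"
  assumes "s < t" "continuous_on {s..t} f" "\<And>u. u \<in> {s<..<t} \<Longrightarrow> 0 < f u"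
  shows "0 < integral {s..t} f"
proof -
  have nonneg: "0 \<le> f u" if "u \<in> {s..t}" for u
  proof (rule continuous_ge_on_closure[where S="{s<..<t}" and f=f])
    show "continuous_on (closure {s<..<t}) f" "u \<in> closure {s<..<t}"
      using assms that by (simp_all add: closure_greaterThanLessThan)
  qed (use assms(3) less_imp_le in blast)
  have "integral {s..t} f \<noteq> 0"
    using integral_eq_0_iff[of s t f] assms nonneg
    by (metis atLeastAtMost_iff dense greaterThanLessThan_iff less_irrefl less_le)
  moreover have "0 \<le> integral {s..t} f"
    using nonneg by (intro integral_nonneg integrable_continuous_interval assms) auto
  ultimately show ?thesis
    by linarith
qed

section \<open>Hitting probability, expected harvest and expected exit time\<close>

context
  fixes \<alpha> \<beta> \<eta> \<theta> :: real
  assumes \<beta>_pos: "\<beta> > 0" and \<eta>_less: "\<eta> < \<theta>"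
begin

private abbreviation (input) "F \<equiv> \<lambda>u. Phi_normal (\<alpha> + \<beta> * u)"
private abbreviation (input) "f \<equiv> \<lambda>u. std_normal_density (\<alpha> + \<beta> * u)"
private abbreviation (input) "G \<equiv> \<lambda>u. (F u - F \<eta>) / f u"
private abbreviation (input) "H \<equiv> \<lambda>u. (F \<theta> - F u) / f u"

lemma hit_prob_endpoints:
  "hit_prob \<alpha> \<beta> \<eta> \<theta> \<eta> = 1" "hit_prob \<alpha> \<beta> \<eta> \<theta> \<theta> = 0"
  using Phi_normal_affine_strict_mono[OF \<beta>_pos \<eta>_less, of \<alpha>] by (auto simp: hit_prob_def)

lemma DERIV_hit_prob:
  "(hit_prob \<alpha> \<beta> \<eta> \<theta> has_real_derivative - (\<beta> * f x) / (F \<theta> - F \<eta>)) (at x within S)"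
proof -
  have "((\<lambda>x. F \<theta> - F x) has_real_derivative - (\<beta> * f x)) (at x within S)"
    using DERIV_diff[OF DERIV_const[of "F \<theta>"] DERIV_Phi_normal_affine] by simp
  from DERIV_cdivide[OF this] show ?thesis
    unfolding hit_prob_def .
qed

text \<open>The denominator is positive; the numerator at \<open>\<eta>\<close> is the expression of
  part A, and at \<open>\<theta>\<close> it is minus the expression of part B.\<close>

lemma DERIV_harvest_mean:
  "(harvest_mean \<alpha> \<beta> \<eta> \<theta> has_real_derivative
      (\<beta> * f x * (\<theta> - \<eta>) - (F \<theta> - F \<eta>)) / (F \<theta> - F \<eta>)) (at x within S)"
proof -
  have eq: "harvest_mean \<alpha> \<beta> \<eta> \<theta> = (\<lambda>x. \<theta> - x + (\<eta> - \<theta>) * hit_prob \<alpha> \<beta> \<eta> \<theta> x)"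
    by (simp add: fun_eq_iff harvest_mean_def harvest_def)
  have "- 1 + (\<eta> - \<theta>) * (- p / d) = (p * (\<theta> - \<eta>) - d) / d" if "d \<noteq> 0" for p d :: real
    using that by (simp add: field_simps)
  from this[of "F \<theta> - F \<eta>" "\<beta> * f x"]
  \<comment> \<open>The unsimplified \<open>0 - 1\<close> is the slope of
    \<open>\<theta> - x\<close> in the form that the derivative rules produce.\<close>
  have slope: "0 - 1 + (\<eta> - \<theta>) * (- (\<beta> * f x) / (F \<theta> - F \<eta>)) =
      (\<beta> * f x * (\<theta> - \<eta>) - (F \<theta> - F \<eta>)) / (F \<theta> - F \<eta>)"
    using Phi_normal_affine_strict_mono[OF \<beta>_pos \<eta>_less, of \<alpha>] by simp
  show ?thesis
    unfolding eq slope[symmetric]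
    by (intro DERIV_add DERIV_diff DERIV_const DERIV_ident DERIV_cmult DERIV_hit_prob)
qed

lemma exit_integrands_continuous: "continuous_on S G" "continuous_on S H"
proof -
  have F: "continuous_on S F"
    by (rule continuous_on_Phi_normal_affine)
  have f: "continuous_on S f"
    by (intro continuous_on_std_normal_density continuous_intros)
  show "continuous_on S G"
    by (rule continuous_on_divide[OF continuous_on_diff[OF F continuous_on_const] f]) simp
  show "continuous_on S H"
    by (rule continuous_on_divide[OF continuous_on_diff[OF continuous_on_const F] f]) simp
qed

lemma exit_integrals_pos: "0 < integral {\<eta>..\<theta>} G" "0 < integral {\<eta>..\<theta>} H"
proof -
  have f: "0 < f u" for u
    by (simp add: normal_density_pos)
  have pos: "0 < G u" "0 < H u" if "u \<in> {\<eta><..<\<theta>}" for u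
    using that Phi_normal_affine_strict_mono[OF \<beta>_pos, of \<eta> u \<alpha>]
      Phi_normal_affine_strict_mono[OF \<beta>_pos, of u \<theta> \<alpha>]
    by (auto intro!: divide_pos_pos f)
  show "0 < integral {\<eta>..\<theta>} G"
    by (rule integral_pos_if_pos_interior[OF \<eta>_less exit_integrands_continuous(1) pos(1)])
  show "0 < integral {\<eta>..\<theta>} H"
    by (rule integral_pos_if_pos_interior[OF \<eta>_less exit_integrands_continuous(2) pos(2)])
qed

text \<open>Product rule, with \<open>x\<close> as upper limit of one integral and lower limit of
  the other, whence the sign of \<open>H x\<close>. The terms with \<open>I\<close> and
  \<open>J\<close> in \<open>slope\<close> come from differentiating the hitting
  probability.\<close>

lemma DERIV_exit_mean:
  assumes "x \<in> {\<eta>..\<theta>}"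
  shows "(exit_mean \<alpha> \<beta> \<eta> \<theta> has_real_derivative
    2 / \<beta> * (hit_prob \<alpha> \<beta> \<eta> \<theta> x * G x - (1 - hit_prob \<alpha> \<beta> \<eta> \<theta> x) * H x +
      \<beta> * f x / (F \<theta> - F \<eta>) * (integral {x..\<theta>} H - integral {\<eta>..x} G)))
    (at x within {\<eta>..\<theta>})"
proof -
  note cont = exit_integrands_continuous
  have dG: "((\<lambda>x. integral {\<eta>..x} G) has_real_derivative G x) (at x within {\<eta>..\<theta>})"
    using assms by (intro integral_has_real_derivative cont)
  have dH: "((\<lambda>x. integral {x..\<theta>} H) has_real_derivative - H x) (at x within {\<eta>..\<theta>})"
    using integral_has_vector_derivative'[OF cont(2) assms]
    by (simp add: has_real_derivative_iff_has_vector_derivative)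
  have slope: "c * ((r * g + - p / d * I) + ((1 - r) * - h + (0 - - p / d) * J)) =
      c * (r * g - (1 - r) * h + p / d * (J - I))" for c r g p d I h J :: real
    by (simp add: algebra_simps diff_divide_distrib)
  show ?thesis
    unfolding exit_mean_def LBINT_cbox_eq_integral[OF cont(1)] LBINT_cbox_eq_integral[OF cont(2)]
    by (rule DERIV_cong[OF _ slope],
        intro DERIV_cmult DERIV_add DERIV_mult' DERIV_diff DERIV_const dG dH DERIV_hit_prob)
qed

lemma harvest_mean_endpoints:
  "harvest_mean \<alpha> \<beta> \<eta> \<theta> \<eta> = 0" "harvest_mean \<alpha> \<beta> \<eta> \<theta> \<theta> = 0"
  by (simp_all add: harvest_mean_def harvest_def hit_prob_endpoints)

text \<open>At each endpoint one weight is zero and the other multiplies an integral over a single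
  point.\<close>

lemma exit_mean_endpoints:
  "exit_mean \<alpha> \<beta> \<eta> \<theta> \<eta> = 0" "exit_mean \<alpha> \<beta> \<eta> \<theta> \<theta> = 0"
  using LBINT_cbox_eq_integral[OF exit_integrands_continuous(1), of \<eta> \<eta>]
    LBINT_cbox_eq_integral[OF exit_integrands_continuous(2), of \<theta> \<theta>]
  by (simp_all add: exit_mean_def hit_prob_endpoints)

section \<open>Limits at the endpoints and their signs\<close>

lemma harvest_rate_tendsto_left_endpoint:
  "(harvest_rate \<alpha> \<beta> \<eta> \<theta> \<longlongrightarrow>
      (\<beta> * f \<eta> * (\<theta> - \<eta>) - (F \<theta> - F \<eta>)) / (2 * f \<eta> * integral {\<eta>..\<theta>} H))
    (at \<eta> within {\<eta><..<\<theta>})"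
proof -
  have D: "F \<theta> - F \<eta> > 0"
    using Phi_normal_affine_strict_mono[OF \<beta>_pos \<eta>_less, of \<alpha>] by simp
  have f: "f \<eta> > 0"
    by (simp add: normal_density_pos)
  have "(exit_mean \<alpha> \<beta> \<eta> \<theta> has_real_derivative 2 * f \<eta> * integral {\<eta>..\<theta>} H / (F \<theta> - F \<eta>))
      (at \<eta> within {\<eta>..\<theta>})"
    \<comment> \<open>At \<open>\<eta>\<close> the hitting probability is 1, while
      \<open>G \<eta>\<close> and the integral of \<open>G\<close> vanish, so only the integral of
      \<open>H\<close> survives.\<close>
    by (rule DERIV_cong[OF DERIV_exit_mean]) (use \<beta>_pos \<eta>_less in \<open>auto simp: hit_prob_endpoints\<close>)
  from DERIV_quotient_tendsto[OF DERIV_harvest_mean this harvest_mean_endpoints(1) exit_mean_endpoints(1)]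
  have "(harvest_rate \<alpha> \<beta> \<eta> \<theta> \<longlongrightarrow>
      (\<beta> * f \<eta> * (\<theta> - \<eta>) - (F \<theta> - F \<eta>)) / (2 * f \<eta> * integral {\<eta>..\<theta>} H)) (at \<eta> within {\<eta>..\<theta>})"
    using D f exit_integrals_pos(2) unfolding harvest_rate_def by simp
  \<comment> \<open>The derivatives are taken within the closed interval; the limit is now
    restricted to the open one.\<close>
  then show ?thesis
    by (rule tendsto_within_subset) auto
qed

lemma harvest_rate_tendsto_right_endpoint:
  "(harvest_rate \<alpha> \<beta> \<eta> \<theta> \<longlongrightarrow>
      (F \<theta> - F \<eta> - \<beta> * f \<theta> * (\<theta> - \<eta>)) / (2 * f \<theta> * integral {\<eta>..\<theta>} G))
    (at \<theta> within {\<eta><..<\<theta>})"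
proof -
  have D: "F \<theta> - F \<eta> > 0"
    using Phi_normal_affine_strict_mono[OF \<beta>_pos \<eta>_less, of \<alpha>] by simp
  have f: "f \<theta> > 0"
    by (simp add: normal_density_pos)
  have "(exit_mean \<alpha> \<beta> \<eta> \<theta> has_real_derivative - (2 * f \<theta> * integral {\<eta>..\<theta>} G) / (F \<theta> - F \<eta>))
      (at \<theta> within {\<eta>..\<theta>})"
    by (rule DERIV_cong[OF DERIV_exit_mean]) (use \<beta>_pos \<eta>_less in \<open>auto simp: hit_prob_endpoints\<close>)
  from DERIV_quotient_tendsto[OF DERIV_harvest_mean this harvest_mean_endpoints(2) exit_mean_endpoints(2)]
  have "(harvest_rate \<alpha> \<beta> \<eta> \<theta> \<longlongrightarrow>
      - ((\<beta> * f \<theta> * (\<theta> - \<eta>) - (F \<theta> - F \<eta>)) / (2 * f \<theta> * integral {\<eta>..\<theta>} G))) (at \<theta> within {\<eta>..\<theta>})"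
    using D f exit_integrals_pos(1) unfolding harvest_rate_def by simp
  \<comment> \<open>The exit time has negative slope at \<open>\<theta>\<close>; its sign is
    absorbed by swapping the difference in the numerator.\<close>
  then show ?thesis
    unfolding minus_divide_left minus_diff_eq by (rule tendsto_within_subset) auto
qed

text \<open>From \<open>- \<alpha> / \<beta>\<close> on, the argument
  \<open>\<alpha> + \<beta> * u\<close> is nonnegative, so moving right increases its square and
  lowers the density. The mean value point \<open>z\<close> thus has a smaller density than
  \<open>\<eta>\<close>.\<close>

lemma Phi_normal_affine_increment_less:
  assumes "- \<alpha> / \<beta> \<le> \<eta>"
  shows "F \<theta> - F \<eta> < \<beta> * f \<eta> * (\<theta> - \<eta>)"
proof -
  obtain z where z: "\<eta> < z" "z < \<theta>" "F \<theta> - F \<eta> = (\<theta> - \<eta>) * (\<beta> * f z)"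
    using MVT2[OF \<eta>_less, of F "\<lambda>u. \<beta> * f u"] DERIV_Phi_normal_affine by blast
  have "0 \<le> \<alpha> + \<beta> * \<eta>"
    using assms \<beta>_pos by (simp add: field_simps)
  moreover have "\<alpha> + \<beta> * \<eta> < \<alpha> + \<beta> * z"
    using z \<beta>_pos by simp
  ultimately have "(\<alpha> + \<beta> * \<eta>)\<^sup>2 < (\<alpha> + \<beta> * z)\<^sup>2"
    by (intro power_strict_mono) auto
  then have "f z < f \<eta>"
    by (simp add: std_normal_density_def divide_strict_right_mono)
  then show ?thesis
    using z \<eta>_less \<beta>_pos by (simp add: mult.commute)
qed

end

theorem proposition3p1:
  fixes a b \<alpha> \<beta> \<eta> \<theta> :: real
  assumes "a < 0" and "b > 0"
    and "\<alpha> = a * sqrt 2 / sqrt b" and "\<beta> = sqrt (2 * b)"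
    and "0 \<le> \<eta>" and "\<eta> < \<theta>"
  shows "(\<exists>\<gamma>. (harvest_rate \<alpha> \<beta> \<eta> \<theta> \<longlongrightarrow> \<gamma>) (at \<eta> within {\<eta><..<\<theta>}) \<and>
              sgn \<gamma> = sgn (Phi_normal (\<alpha> + \<beta> * \<eta>)
                        + \<beta> * std_normal_density (\<alpha> + \<beta> * \<eta>) * (\<theta> - \<eta>)
                        - Phi_normal (\<alpha> + \<beta> * \<theta>)) \<and>
              (- \<alpha> / \<beta> \<le> \<eta> \<longrightarrow> \<gamma> > 0)) \<and>
         (\<exists>\<gamma>. (harvest_rate \<alpha> \<beta> \<eta> \<theta> \<longlongrightarrow> \<gamma>) (at \<theta> within {\<eta><..<\<theta>}) \<and>
              sgn \<gamma> = sgn (Phi_normal (\<alpha> + \<beta> * \<theta>)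
                        + \<beta> * std_normal_density (\<alpha> + \<beta> * \<theta>) * (\<eta> - \<theta>)
                        - Phi_normal (\<alpha> + \<beta> * \<eta>)))"
proof -
  let ?F = "\<lambda>u. Phi_normal (\<alpha> + \<beta> * u)"
  let ?f = "\<lambda>u. std_normal_density (\<alpha> + \<beta> * u)"
  have \<beta>: "\<beta> > 0"
    using assms by simp
  have f: "?f u > 0" for u
    by (simp add: normal_density_pos)
  have sgn_quotient: "sgn (p / (2 * ?f u * q)) = sgn p" if "q > 0" for p q u
    using that f[of u] by (simp add: sgn_divide sgn_mult)
  note I = exit_integrals_pos[OF \<beta> \<open>\<eta> < \<theta>\<close>, of \<alpha>]
  show ?thesis
  proof (intro conjI exI)
    \<comment> \<open>The witness left open by \<open>exI\<close> is fixed by the limit statement,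
      which therefore precedes the claims on its sign.\<close>
    show "(harvest_rate \<alpha> \<beta> \<eta> \<theta> \<longlongrightarrow> (\<beta> * ?f \<eta> * (\<theta> - \<eta>) - (?F \<theta> - ?F \<eta>)) /
        (2 * ?f \<eta> * integral {\<eta>..\<theta>} (\<lambda>u. (?F \<theta> - ?F u) / ?f u))) (at \<eta> within {\<eta><..<\<theta>})"
      by (rule harvest_rate_tendsto_left_endpoint[OF \<beta> \<open>\<eta> < \<theta>\<close>])
    show "sgn ((\<beta> * ?f \<eta> * (\<theta> - \<eta>) - (?F \<theta> - ?F \<eta>)) /
        (2 * ?f \<eta> * integral {\<eta>..\<theta>} (\<lambda>u. (?F \<theta> - ?F u) / ?f u))) =
        sgn (?F \<eta> + \<beta> * ?f \<eta> * (\<theta> - \<eta>) - ?F \<theta>)"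
      unfolding sgn_quotient[OF I(2)] by (rule arg_cong[of _ _ sgn]) simp
    show "- \<alpha> / \<beta> \<le> \<eta> \<longrightarrow> (\<beta> * ?f \<eta> * (\<theta> - \<eta>) - (?F \<theta> - ?F \<eta>)) /
        (2 * ?f \<eta> * integral {\<eta>..\<theta>} (\<lambda>u. (?F \<theta> - ?F u) / ?f u)) > 0"
      using Phi_normal_affine_increment_less[OF \<beta> \<open>\<eta> < \<theta>\<close>, of \<alpha>] I(2) f
      by (intro impI divide_pos_pos mult_pos_pos) auto
    show "(harvest_rate \<alpha> \<beta> \<eta> \<theta> \<longlongrightarrow> (?F \<theta> - ?F \<eta> - \<beta> * ?f \<theta> * (\<theta> - \<eta>)) /
        (2 * ?f \<theta> * integral {\<eta>..\<theta>} (\<lambda>u. (?F u - ?F \<eta>) / ?f u))) (at \<theta> within {\<eta><..<\<theta>})"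
      by (rule harvest_rate_tendsto_right_endpoint[OF \<beta> \<open>\<eta> < \<theta>\<close>])
    show "sgn ((?F \<theta> - ?F \<eta> - \<beta> * ?f \<theta> * (\<theta> - \<eta>)) /
        (2 * ?f \<theta> * integral {\<eta>..\<theta>} (\<lambda>u. (?F u - ?F \<eta>) / ?f u))) =
        sgn (?F \<theta> + \<beta> * ?f \<theta> * (\<eta> - \<theta>) - ?F \<eta>)"
      unfolding sgn_quotient[OF I(1)] by (rule arg_cong[of _ _ sgn]) (simp add: algebra_simps)
  qed
qed

end
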